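(* Let $(\mathcal{F},* )$ be a symmetric fusion law with $\mathcal{F}\subseteq\mathbb{C}$, $1\in\mathcal{F}$ and $|\mathcal{F}|=2$, and let $V=\langle\langle a_0,a_1\rangle\rangle$ be a primitive $(\mathcal{F},* )$-axial algebra over $\mathbb{C}$ generated by two $(\mathcal{F},* )$-axes $a_0,a_1$. Then $V$ is either the $1$-dimensional algebra $1A$ or the $2$-dimensional algebra $2B(\alpha)$ for some $\alpha\in\mathbb{C}$. If additionally $V$ is assumed to be graded, then either $V$ is the algebra $1A$ or $V$ is the algebra $2B(\alpha)$ with $\alpha\in\{-1,\tfrac12\}$.
   Context: All algebras are commutative but not necessarily associative. $\langle\langle X\rangle\rangle$ denotes the subalgebra generated by $X$. A fusion law is a pair $(\mathcal{F},* )$ with $\mathcal{F}$ a set and $*:\mathcal{F}\times\mathcal{F}\to 2^{\mathcal{F}}$ a map; it is symmetric if $x*y=y*x$ for all $x,y$. For a group $G$, a $G$-grading of $(\mathcal{F},* )$ is a map $f:\mathcal{F}\to G$ such that $f(z)=f(x)f(y)$ whenever $z\in x*y$; it is adequate if $f(\mathcal{F})$ generates $G$, and non-trivial if $G$ is not the trivial group. The fusion law is graded if it admits an adequate non-trivial grading. Let $V$ be a commutative $\mathbb{C}$-algebra. For $a\in V$, $\lambda\in\mathbb{C}$ and $\Lambda\subseteq\mathbb{C}$ put $V_\lambda^a=\{u\in V: au=\lambda u\}$ and $V_\Lambda^a=\sum_{\lambda\in\Lambda}V_\lambda^a$ (so $V_\emptyset^a=0$). An idempotent $a\in V$ is an $(\mathcal{F},*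 )$-axis if $V=V_{\mathcal{F}}^a$ and $V_\lambda^aV_\mu^a\subseteq V_{\lambda*\mu}^a$ for all $\lambda,\mu\in\mathcal{F}$; axes are assumed to be non-zero. An axis $a$ is primitive if $V_1^a=\mathbb{C}a$. An $(\mathcal{F},* )$-axial algebra is an algebra generated by a set of $(\mathcal{F},* )$-axes; it is primitive if all the generating axes are primitive, and graded if $(\mathcal{F},* )$ is graded. The algebra $1A$ is the $1$-dimensional algebra spanned by a non-zero idempotent. An algebra is the algebra $2B(\alpha)$ if it is generated by two distinct non-zero idempotents $a_0,a_1$ with $a_0a_1=\alpha(a_0+a_1)$. *)

theory Defs
  imports Complex_Main "HOL-Algebra.Elementary_Groups"
begin

section \<open>Fusion laws and their gradings\<close>

text \<open>Only the values of \<open>star\<close> on \<open>F \<times> F\<close> are relevant.\<close>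

definition fusion_law :: "'f set \<Rightarrow> ('f \<Rightarrow> 'f \<Rightarrow> 'f set) \<Rightarrow> bool" where
  "fusion_law F star \<longleftrightarrow> (\<forall>x\<in>F. \<forall>y\<in>F. star x y \<subseteq> F)"

definition symmetric_fusion_law :: "'f set \<Rightarrow> ('f \<Rightarrow> 'f \<Rightarrow> 'f set) \<Rightarrow> bool" where
  "symmetric_fusion_law F star \<longleftrightarrow>
     fusion_law F star \<and> (\<forall>x\<in>F. \<forall>y\<in>F. star x y = star y x)"

definition fusion_grading ::
  "('g, 'm) monoid_scheme \<Rightarrow> 'f set \<Rightarrow> ('f \<Rightarrow> 'f \<Rightarrow> 'f set) \<Rightarrow> ('f \<Rightarrow> 'g) \<Rightarrow> bool" where
  "fusion_grading G F star f \<longleftrightarrow>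
     group G \<and> f ` F \<subseteq> carrier G \<and>
     (\<forall>x\<in>F. \<forall>y\<in>F. \<forall>z\<in>star x y. f z = f x \<otimes>\<^bsub>G\<^esub> f y)"

definition adequate_grading ::
  "('g, 'm) monoid_scheme \<Rightarrow> 'f set \<Rightarrow> ('f \<Rightarrow> 'f \<Rightarrow> 'f set) \<Rightarrow> ('f \<Rightarrow> 'g) \<Rightarrow> bool" where
  "adequate_grading G F star f \<longleftrightarrow>
     fusion_grading G F star f \<and> generate G (f ` F) = carrier G"

text \<open>
  HOL cannot quantify over the type of the elements of the grading group inside a formula,
  so this type is a parameter. When gradedness is used as a hypothesis with a free type
  variable \<open>'g\<close>, the resulting theorem covers grading groups over every type.
\<close>

definition graded_fusion_law ::
  "'g itself \<Rightarrow> 'f set \<Rightarrow> ('f \<Rightarrow> 'f \<Rightarrow> 'f set) \<Rightarrow> bool" where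
  "graded_fusion_law (_ :: 'g itself) F star \<longleftrightarrow>
     (\<exists>(G :: 'g monoid) f. adequate_grading G F star f \<and> \<not> trivial_group G)"

section \<open>Commutative non-associative complex algebras and axes\<close>

text \<open>The algebra is the whole type \<open>'v\<close>; it need not be associative, unital or finite-dimensional.\<close>

locale comm_algebra = vector_space scale
  for scale :: "complex \<Rightarrow> 'v::ab_group_add \<Rightarrow> 'v" (infixr \<open>*s\<close> 75) +
  fixes mult :: "'v \<Rightarrow> 'v \<Rightarrow> 'v" (infixl \<open>\<cdot>\<close> 70)
  assumes mult_commute: "x \<cdot> y = y \<cdot> x"
    and mult_add_right: "x \<cdot> (y + z) = x \<cdot> y + x \<cdot> z"
    and mult_scale_right: "x \<cdot> (c *s y) = c *s (x \<cdot> y)"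
begin

definition subalgebra :: "'v set \<Rightarrow> bool" where
  "subalgebra S \<longleftrightarrow> subspace S \<and> (\<forall>x\<in>S. \<forall>y\<in>S. x \<cdot> y \<in> S)"

definition generated_subalgebra :: "'v set \<Rightarrow> 'v set" where
  "generated_subalgebra X = subalgebra hull X"

definition idempotent :: "'v \<Rightarrow> bool" where
  "idempotent a \<longleftrightarrow> a \<cdot> a = a"

definition eigenspace :: "'v \<Rightarrow> complex \<Rightarrow> 'v set" where
  "eigenspace a l = {u. a \<cdot> u = l *s u}"

text \<open>The sum of a family of subspaces is the span of their union.\<close>

definition eigenspace_sum :: "'v \<Rightarrow> complex set \<Rightarrow> 'v set" where
  "eigenspace_sum a L = span (\<Union>l\<in>L. eigenspace a l)"

definition is_axis :: "complex set \<Rightarrow> (complex \<Rightarrow> complex \<Rightarrow> complex set) \<Rightarrow> 'v \<Rightarrow> bool" where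
  "is_axis F star a \<longleftrightarrow>
     a \<noteq> 0 \<and> idempotent a \<and> eigenspace_sum a F = UNIV \<and>
     (\<forall>l\<in>F. \<forall>m\<in>F. \<forall>u\<in>eigenspace a l. \<forall>v\<in>eigenspace a m. u \<cdot> v \<in> eigenspace_sum a (star l m))"

definition is_primitive_axis ::
  "complex set \<Rightarrow> (complex \<Rightarrow> complex \<Rightarrow> complex set) \<Rightarrow> 'v \<Rightarrow> bool" where
  "is_primitive_axis F star a \<longleftrightarrow> is_axis F star a \<and> eigenspace a 1 = span {a}"

definition axial_algebra ::
  "complex set \<Rightarrow> (complex \<Rightarrow> complex \<Rightarrow> complex set) \<Rightarrow> 'v set \<Rightarrow> bool" where
  "axial_algebra F star A \<longleftrightarrow>
     (\<forall>a\<in>A. is_axis F star a) \<and> generated_subalgebra A = UNIV"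

definition primitive_axial_algebra ::
  "complex set \<Rightarrow> (complex \<Rightarrow> complex \<Rightarrow> complex set) \<Rightarrow> 'v set \<Rightarrow> bool" where
  "primitive_axial_algebra F star A \<longleftrightarrow>
     axial_algebra F star A \<and> (\<forall>a\<in>A. is_primitive_axis F star a)"

definition is_1A :: bool where
  "is_1A \<longleftrightarrow> dim UNIV = 1 \<and> (\<exists>a. a \<noteq> 0 \<and> idempotent a \<and> span {a} = UNIV)"

definition is_2B :: "complex \<Rightarrow> bool" where
  "is_2B \<alpha> \<longleftrightarrow>
     (\<exists>a\<^sub>0 a\<^sub>1. a\<^sub>0 \<noteq> a\<^sub>1 \<and> a\<^sub>0 \<noteq> 0 \<and> a\<^sub>1 \<noteq> 0 \<and> idempotent a\<^sub>0 \<and> idempotent a\<^sub>1 \<and>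
        a\<^sub>0 \<cdot> a\<^sub>1 = \<alpha> *s (a\<^sub>0 + a\<^sub>1) \<and> generated_subalgebra {a\<^sub>0, a\<^sub>1} = UNIV)"

end

end

theory Submission
  imports Defs
begin

text \<open>
  Let \<open>F = {1, \<mu>}\<close>. Each axis acts as \<open>1\<close> on its own line and as \<open>\<mu>\<close> on a complement, so
  \<open>a\<^sub>0a\<^sub>1\<close> equals \<open>\<lambda>(1 - \<mu>)a\<^sub>0 + \<mu>a\<^sub>1\<close> and also \<open>\<mu>a\<^sub>0 + \<lambda>'(1 - \<mu>)a\<^sub>1\<close>. Distinct non-zero idempotents
  are linearly independent, hence \<open>a\<^sub>0a\<^sub>1 = \<mu>(a\<^sub>0 + a\<^sub>1)\<close> with \<open>\<lambda>(1 - \<mu>) = \<mu>\<close>. A grading forces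
  \<open>\<mu> * \<mu> \<subseteq> {1}\<close>, so the square of \<open>a\<^sub>1 - \<lambda>a\<^sub>0\<close> lies on the line of \<open>a\<^sub>0\<close>; its coefficient at
  \<open>a\<^sub>1\<close> is \<open>1 - 2\<lambda>\<mu>\<close>, which gives \<open>2\<mu>\<^sup>2 + \<mu> - 1 = 0\<close>.
\<close>

text \<open>A grading sends \<open>e\<close> to the identity because \<open>e\<close> lies in
  \<open>star e e\<close>. If \<open>m\<close> lay in \<open>star m m\<close>, its image would be
  the identity too, and adequacy would make \<open>G\<close> trivial.\<close>

lemma graded_two_element_fusion_law:
  fixes e m :: 'f
  assumes graded: "graded_fusion_law TYPE('g) {e, m} star"
    and law: "fusion_law {e, m} star"
    and unit: "e \<in> star e e"
  shows "star m m \<subseteq> {e}"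
proof -
  obtain G :: "'g monoid" and f where G: "group G" and carr: "f e \<in> carrier G" "f m \<in> carrier G"
    and mult: "\<forall>x\<in>{e, m}. \<forall>y\<in>{e, m}. \<forall>z\<in>star x y. f z = f x \<otimes>\<^bsub>G\<^esub> f y"
    and gen: "generate G {f e, f m} = carrier G" and nontriv: "\<not> trivial_group G"
    using graded unfolding graded_fusion_law_def adequate_grading_def fusion_grading_def by auto
  interpret group G by (fact G)
  have fe: "f e = \<one>\<^bsub>G\<^esub>"
    using mult unit carr l_cancel_one'[of "f e" "f e"] by blast
  have "m \<notin> star m m"
  proof
    assume "m \<in> star m m"
    then have "f m = \<one>\<^bsub>G\<^esub>"
      using mult carr l_cancel_one'[of "f m" "f m"] by blast
    then have "carrier G = {\<one>\<^bsub>G\<^esub>}"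
      using gen fe generate_one by auto
    then show False
      using nontriv G by (simp add: trivial_group_def)
  qed
  then show ?thesis
    using law unfolding fusion_law_def by blast
qed

context comm_algebra
begin

lemma mult_add_left: "(x + y) \<cdot> z = x \<cdot> z + y \<cdot> z"
  by (metis mult_commute mult_add_right)

lemma mult_scale_left: "(c *s x) \<cdot> y = c *s (x \<cdot> y)"
  by (metis mult_commute mult_scale_right)

lemma mult_zero_right: "x \<cdot> 0 = 0"
  using mult_scale_right[of x 0 0] by simp

lemma mult_zero_left: "0 \<cdot> x = 0"
  using mult_scale_left[of 0 0 x] by simp

lemma subspace_eigenspace: "subspace (eigenspace a l)"
  unfolding subspace_def eigenspace_def
  by (auto simp: mult_zero_right mult_add_right mult_scale_right scale_right_distrib scale_left_commute)

lemma eigenspace_sum_mono: "L \<subseteq> M \<Longrightarrow> eigenspace_sum a L \<subseteq> eigenspace_sum a M"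
  unfolding eigenspace_sum_def by (intro span_mono) auto

lemma eigenspace_sum_singleton: "eigenspace_sum a {l} = eigenspace a l"
  unfolding eigenspace_sum_def by (simp add: span_eq_iff subspace_eigenspace)

lemma span_mult_closed:
  assumes gens: "\<And>x y. x \<in> X \<Longrightarrow> y \<in> X \<Longrightarrow> x \<cdot> y \<in> span X"
    and "u \<in> span X" "v \<in> span X"
  shows "u \<cdot> v \<in> span X"
proof -
  \<comment> \<open>Bilinearity, one factor at a time: first the right factor runs through the span
    against a fixed generator, then the left one.\<close>
  have step: "x \<cdot> v \<in> span X" if "x \<in> X" for x
    using \<open>v \<in> span X\<close>
    by (rule span_induct)
      (auto simp: subspace_def mult_zero_right mult_add_right mult_scale_right
        span_zero span_add span_scale gens that)
  show ?thesis
    using \<open>u \<in> span X\<close>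
    by (rule span_induct)
      (auto simp: subspace_def mult_zero_left mult_add_left mult_scale_left
        span_zero span_add span_scale step)
qed

lemma span_generated_UNIV:
  assumes "generated_subalgebra X = UNIV"
    and "\<And>x y. x \<in> X \<Longrightarrow> y \<in> X \<Longrightarrow> x \<cdot> y \<in> span X"
  shows "span X = UNIV"
proof -
  have "subalgebra (span X)"
    unfolding subalgebra_def using span_mult_closed assms(2) by (auto intro: subspace_span)
  then have "generated_subalgebra X \<subseteq> span X"
    unfolding generated_subalgebra_def by (intro hull_minimal span_superset)
  with assms(1) show ?thesis by auto
qed

text \<open>If \<open>a = c *s b\<close>, then squaring gives \<open>a = c *s a\<close>, so
  \<open>c = 1\<close> and \<open>a = b\<close>. This form allows coefficients of two idempotents to
  be compared.\<close>

lemma idempotents_not_proportional: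
  assumes "idempotent a" "idempotent b" "a \<noteq> 0" "a \<noteq> b" "p *s a = q *s b"
  shows "p = 0"
proof (rule ccontr)
  assume "p \<noteq> 0"
  then have ab: "a = (q / p) *s b"
    using arg_cong[OF assms(5), of "scale (1 / p)"] by simp
  define c where "c = q / p"
  have ac: "a = c *s b" using ab by (simp add: c_def)
  have "a \<cdot> a = c *s (c *s b)"
    using assms(2) by (simp add: ac mult_scale_left mult_scale_right idempotent_def)
  then have "c *s a = a"
    using assms(1) ac by (simp add: idempotent_def)
  then have "c = 1"
    using assms(3) scale_cancel_right[of c a 1] by simp
  with ac assms(4) show False by simp
qed

lemma primitive_axis_decomposition:
  assumes "is_primitive_axis {1, m} star a"
  obtains c v where "x = c *s a + v" "a \<cdot> v = m *s v"
proof -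
  have "eigenspace_sum a {1, m} = UNIV"
    using assms by (simp add: is_primitive_axis_def is_axis_def)
  then have "x \<in> span (eigenspace a 1 \<union> eigenspace a m)"
    by (simp add: eigenspace_sum_def)
  then obtain u v where "x = u + v" "u \<in> span (eigenspace a 1)" "v \<in> span (eigenspace a m)"
    unfolding span_Un by blast
  moreover have "span (eigenspace a 1) = span {a}"
    using assms unfolding is_primitive_axis_def by simp
  moreover have "span (eigenspace a m) = eigenspace a m"
    by (simp add: span_eq_iff subspace_eigenspace)
  ultimately show ?thesis
    using that unfolding span_singleton eigenspace_def by auto
qed

text \<open>Here \<open>c *s a\<close> is the component of \<open>x\<close> on the line of
  \<open>a\<close>, and \<open>x - c *s a\<close> is the component in the
  \<open>m\<close>-eigenspace. Multiplication by \<open>a\<close> fixes the former and scales the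
  latter by \<open>m\<close>.\<close>

lemma primitive_axis_mult:
  assumes "is_primitive_axis {1, m} star a"
  obtains c where "a \<cdot> (x - c *s a) = m *s (x - c *s a)"
    "a \<cdot> x = (c * (1 - m)) *s a + m *s x"
proof -
  obtain c v where xv: "x = c *s a + v" and v: "a \<cdot> v = m *s v"
    using primitive_axis_decomposition[OF assms] by blast
  have "a \<cdot> a = a"
    using assms unfolding is_primitive_axis_def is_axis_def idempotent_def by simp
  then have "a \<cdot> x = (c * (1 - m)) *s a + m *s x"
    by (simp add: xv v mult_add_right mult_scale_right scale_right_distrib algebra_simps
        scale_left_diff_distrib)
  moreover have "x - c *s a = v" using xv by simp
  ultimately show ?thesis using that v by metis
qed

text \<open>Otherwise the fusion rule for \<open>a \<cdot> a = a\<close> would make \<open>a\<close>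
  an \<open>m\<close>-eigenvector as well as a 1-eigenvector.\<close>

lemma unit_in_star:
  assumes "is_axis {1, m} star a" "fusion_law {1, m} star" "m \<noteq> 1"
  shows "1 \<in> star 1 1"
proof (rule ccontr)
  assume "1 \<notin> star 1 1"
  then have "star 1 1 \<subseteq> {m}"
    using assms(2) unfolding fusion_law_def by blast
  moreover have a: "a \<cdot> a = a" "a \<noteq> 0"
    using assms(1) unfolding is_axis_def idempotent_def by auto
  moreover have "a \<cdot> a \<in> eigenspace_sum a (star 1 1)"
    using assms(1) a unfolding is_axis_def eigenspace_def by auto
  ultimately have "a \<in> eigenspace a m"
    using eigenspace_sum_mono[of "star 1 1" "{m}" a] by (auto simp: eigenspace_sum_singleton)
  then have "m *s a = 1 *s a"
    using a by (simp add: eigenspace_def)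
  then show False using a assms(3) scale_cancel_right[of m a 1] by simp
qed

lemma is_1A_generated:
  assumes "a \<noteq> 0" "idempotent a" "generated_subalgebra {a} = UNIV"
  shows is_1A
proof -
  have sp: "span {a} = UNIV"
    using assms by (intro span_generated_UNIV) (auto simp: idempotent_def intro: span_base)
  have "dim UNIV = card {a}"
    using assms(1) sp by (intro dim_eq_card) (auto simp: span_UNIV)
  with sp assms show ?thesis unfolding is_1A_def by auto
qed

text \<open>The relation for \<open>a \<cdot> b\<close> makes the span of \<open>a\<close> and
  \<open>b\<close> closed under products, hence everything; independence holds since distinct
  non-zero idempotents are not proportional.\<close>

lemma is_2B_dim:
  assumes "a \<noteq> b" "a \<noteq> 0" "b \<noteq> 0" "idempotent a" "idempotent b"
    and "a \<cdot> b = \<alpha> *s (a + b)" "generated_subalgebra {a, b} = UNIV"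
  shows "dim UNIV = 2"
proof -
  have mem: "a \<in> span {a, b}" "b \<in> span {a, b}" by (auto intro: span_base)
  then have "a \<cdot> b \<in> span {a, b}"
    using assms(6) by (auto intro: span_add span_scale)
  with mem assms have sp: "span {a, b} = UNIV"
    by (intro span_generated_UNIV) (auto simp: idempotent_def mult_commute[of b a])
  have "a \<notin> span {b}"
  proof
    assume "a \<in> span {b}"
    then obtain k where "1 *s a = k *s b" by (auto simp: span_singleton)
    from idempotents_not_proportional[OF assms(4,5,2,1) this] show False by simp
  qed
  then have "independent {a, b}"
    using assms(1,3) by (simp add: independent_insert)
  then have "dim UNIV = card {a, b}"
    using sp by (intro dim_eq_card) (auto simp: span_UNIV)
  with assms(1) show ?thesis by simp
qed

lemma two_primitive_axes_mult:
  assumes a: "is_primitive_axis {1, m} star a" and b: "is_primitive_axis {1, m} star b"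
    and "a \<noteq> b"
  obtains c where "c * (1 - m) = m" "a \<cdot> b = m *s (a + b)"
    "a \<cdot> (b - c *s a) = m *s (b - c *s a)"
proof -
  have idem: "idempotent a" "idempotent b" "a \<noteq> 0"
    using a b unfolding is_primitive_axis_def is_axis_def by auto
  obtain c where c: "a \<cdot> (b - c *s a) = m *s (b - c *s a)"
    and ab: "a \<cdot> b = (c * (1 - m)) *s a + m *s b"
    using primitive_axis_mult[OF a] by blast
  obtain d where "b \<cdot> a = (d * (1 - m)) *s b + m *s a"
    using primitive_axis_mult[OF b] by blast
  then have "(c * (1 - m)) *s a + m *s b = (d * (1 - m)) *s b + m *s a"
    using ab by (simp add: mult_commute)
  \<comment> \<open>Only the coefficient of \<open>a\<close> is compared: that of \<open>b\<close>
    in \<open>ab\<close> is already \<open>m\<close>, so \<open>d\<close> need not be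
    computed.\<close>
  then have "(c * (1 - m) - m) *s a = (d * (1 - m) - m) *s b"
    by (simp only: scale_left_diff_distrib) (simp add: algebra_simps)
  from idempotents_not_proportional[OF idem(1,2,3) \<open>a \<noteq> b\<close> this]
  have cm: "c * (1 - m) = m" by simp
  then have "a \<cdot> b = m *s (a + b)"
    using ab by (simp add: scale_right_distrib)
  with cm c show ?thesis using that by blast
qed

lemma graded_eigenvalue:
  assumes a: "is_primitive_axis {1, m} star a" and b: "is_primitive_axis {1, m} star b"
    and "a \<noteq> b" and star: "star m m \<subseteq> {1}"
  shows "m \<in> {-1, 1/2}"
proof -
  have idem: "idempotent a" "idempotent b" "b \<noteq> 0"
    using a b unfolding is_primitive_axis_def is_axis_def by auto
  obtain c where cm: "c * (1 - m) = m" and ab: "a \<cdot> b = m *s (a + b)"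
    and eig: "a \<cdot> (b - c *s a) = m *s (b - c *s a)"
    using two_primitive_axes_mult[OF a b \<open>a \<noteq> b\<close>] by blast
  define v where "v = b + (-c) *s a"
  have "v \<in> eigenspace a m"
    using eig by (simp add: v_def eigenspace_def)
  then have "v \<cdot> v \<in> eigenspace_sum a (star m m)"
    using a unfolding is_primitive_axis_def is_axis_def by auto
  \<comment> \<open>By primitivity the 1-eigenspace of \<open>a\<close> is its line.\<close>
  then have "v \<cdot> v \<in> span {a}"
    using a eigenspace_sum_mono[OF star, of a]
    by (auto simp: eigenspace_sum_singleton is_primitive_axis_def)
  then obtain k where k: "v \<cdot> v = k *s a" by (auto simp: span_singleton)
  have "v \<cdot> v = b \<cdot> b + (-c) *s (a \<cdot> b) + (-c) *s (a \<cdot> b) + (c * c) *s (a \<cdot> a)"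
    unfolding v_def mult_add_left mult_add_right mult_scale_left mult_scale_right mult_commute[of b a]
    by (simp add: algebra_simps)
  \<comment> \<open>Each of the two cross terms contributes \<open>- c * m\<close> to both
    coefficients.\<close>
  also have "\<dots> = (1 - 2 * c * m) *s b + (c * c - 2 * c * m) *s a"
  proof -
    have double: "2 * c * m = c * m + c * m" by simp
    have "(1 - 2 * c * m) *s b = b - (c * m) *s b - (c * m) *s b"
      by (simp only: double scale_left_diff_distrib scale_left_distrib scale_one diff_diff_eq)
    moreover have "(c * c - 2 * c * m) *s a = (c * c) *s a - (c * m) *s a - (c * m) *s a"
      by (simp only: double scale_left_diff_distrib scale_left_distrib diff_diff_eq)
    ultimately show ?thesis
      using idem ab by (simp add: idempotent_def scale_right_distrib algebra_simps)
  qed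
  finally have "(1 - 2 * c * m) *s b = (k - (c * c - 2 * c * m)) *s a"
    using k by (simp only: scale_left_diff_distrib[of k]) (simp add: algebra_simps)
  from idempotents_not_proportional[OF idem(2,1,3) \<open>a \<noteq> b\<close>[symmetric] this]
  have "2 * c * m = 1" by simp
  \<comment> \<open>Multiplying by \<open>1 - m\<close> lets \<open>c * (1 - m) = m\<close>
    eliminate \<open>c\<close>, leaving a quadratic in \<open>m\<close>.\<close>
  then have "2 * (c * (1 - m)) * m = 1 - m" by (simp add: algebra_simps)
  then have "2 * m * m = 1 - m" by (simp only: cm)
  then have "(2 * m - 1) * (m + 1) = 0" by (simp add: algebra_simps)
  then consider "2 * m = 1" | "m = -1"
    by (auto simp: eq_neg_iff_add_eq_0)
  then show ?thesis by cases (simp_all add: field_simps)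
qed

end

theorem theorem1p2:
  fixes scale :: "complex \<Rightarrow> 'v::ab_group_add \<Rightarrow> 'v"
    and mult :: "'v \<Rightarrow> 'v \<Rightarrow> 'v"
    and F :: "complex set"
    and star :: "complex \<Rightarrow> complex \<Rightarrow> complex set"
    and a\<^sub>0 a\<^sub>1 :: 'v
  assumes "comm_algebra scale mult"
    and "symmetric_fusion_law F star"
    and "1 \<in> F"
    and "card F = 2"
    and "comm_algebra.primitive_axial_algebra scale mult F star {a\<^sub>0, a\<^sub>1}"
  shows "(comm_algebra.is_1A scale mult \<or>
            (vector_space.dim scale (UNIV :: 'v set) = 2 \<and>
             (\<exists>\<alpha>. comm_algebra.is_2B scale mult \<alpha>))) \<and>
         (graded_fusion_law TYPE('g) F star \<longrightarrow>
            comm_algebra.is_1A scale mult \<or>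
            (vector_space.dim scale (UNIV :: 'v set) = 2 \<and>
             (\<exists>\<alpha>\<in>{-1, 1/2}. comm_algebra.is_2B scale mult \<alpha>)))"
proof -
  interpret comm_algebra scale mult by (fact assms(1))
  obtain m where F: "F = {1, m}" and "m \<noteq> 1"
    using assms(3,4) by (auto simp: card_2_iff)
  have law: "fusion_law {1, m} star"
    using assms(2) F by (simp add: symmetric_fusion_law_def)
  have a: "is_primitive_axis {1, m} star a\<^sub>0" "is_primitive_axis {1, m} star a\<^sub>1"
    and gen: "generated_subalgebra {a\<^sub>0, a\<^sub>1} = UNIV"
    using assms(5) F unfolding primitive_axial_algebra_def axial_algebra_def by auto
  then have axis: "is_axis {1, m} star a\<^sub>0"
    and idem: "idempotent a\<^sub>0" "idempotent a\<^sub>1" "a\<^sub>0 \<noteq> 0" "a\<^sub>1 \<noteq> 0"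
    unfolding is_primitive_axis_def is_axis_def by auto
  show ?thesis
  proof (cases "a\<^sub>0 = a\<^sub>1")
    case True
    \<comment> \<open>Coinciding axes leave a single idempotent as generator.\<close>
    then have is_1A using is_1A_generated idem gen by auto
    then show ?thesis by simp
  next
    case False
    then have prod: "mult a\<^sub>0 a\<^sub>1 = scale m (a\<^sub>0 + a\<^sub>1)"
      using two_primitive_axes_mult[OF a] by blast
    \<comment> \<open>The parameter is the eigenvalue \<open>m\<close> itself, so this witness
      serves both conclusions; a grading merely restricts its value.\<close>
    then have "is_2B m"
      unfolding is_2B_def using False idem gen by blast
    moreover have "dim UNIV = 2"
      using is_2B_dim[OF False idem(3,4,1,2) prod gen] .
    moreover have "m \<in> {-1, 1/2}" if "graded_fusion_law TYPE('g) F star"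
      using graded_eigenvalue[OF a False graded_two_element_fusion_law[OF that[unfolded F] law
            unit_in_star[OF axis law \<open>m \<noteq> 1\<close>]]] .
    ultimately show ?thesis by blast
  qed
qed

end
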